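(* Every reversible gate class $\mathcal{C}$ is dual-closed: if $F\in\mathcal{C}$ then $F^{\ast}\in\mathcal{C}$.
   Context: A reversible gate (equivalently, reversible transformation) on $n\ge 1$ bits is a permutation of $\{0,1\}^n$. A gate set is any, possibly infinite, set of reversible gates, possibly on different numbers of bits. For a gate set $S$, $\langle S\rangle$ is the smallest set of reversible transformations such that: (1) it contains $S$ and the identity on $\{0,1\}^n$ for all $n\ge1$; (2) if it contains $F$ and $G$ on $n$ bits, it contains $F\circ G$; (3) if it contains $F$ on $n$ bits, it contains every function obtained from $F$ by permuting its input bits and permuting its output bits; (4) if it contains $F$ on $n$ bits, it contains the $(n+1)$-bit map $(x,b)\mapsto(F(x),b)$; (5) (ancilla rule) if it contains $F$ on $n+k$ bits and there are a fixed string $a\in\{0,1\}^k$ and an $n$-bit transformation $G$ with $F(x,a)=(G(x),a)$ for all $x\in\{0,1\}^n$, then it contains $G$. A reversible gate class is a set of reversible transformations of the form $\langle S\rangle$ for some gate set $S$. For an $n$-bit reversible transformation $F$, its dual is $F^{\ast}(x):=\overline{F(\overline{x})}$, where $\overline{x}$ denotes the bitwise complement of $x$. *)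

theory Defs
  imports "HOL-Combinatorics.Combinatorics"
begin

text \<open>
  Bit strings are lists of Booleans. A gate is a pair \<open>(n, F)\<close> of its number of bits and its
  map; the map is normalised to be the identity on lists of length other than \<open>n\<close>, so that equal
  gates are equal pairs. The first component is needed because the identity map is a gate
  on \<open>n\<close> bits for every \<open>n\<close>.
\<close>

type_synonym gate = "nat \<times> (bool list \<Rightarrow> bool list)"

definition bitstrings :: "nat \<Rightarrow> bool list set" where
  "bitstrings n = {x. length x = n}"

definition reversible_gates :: "gate set" where
  "reversible_gates = {(n, F). 1 \<le> n \<and> F permutes bitstrings n}"

definition on_bits :: "nat \<Rightarrow> (bool list \<Rightarrow> bool list) \<Rightarrow> bool list \<Rightarrow> bool list" where
  "on_bits n f = (\<lambda>x. if length x = n then f x else x)"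

inductive_set generated :: "gate set \<Rightarrow> gate set" for S :: "gate set" where
  base: "g \<in> S \<Longrightarrow> g \<in> generated S"
| identity: "1 \<le> n \<Longrightarrow> (n, id) \<in> generated S"
| composition:
    "(n, F) \<in> generated S \<Longrightarrow> (n, G) \<in> generated S \<Longrightarrow> (n, F \<circ> G) \<in> generated S"
| permutation:
    "(n, F) \<in> generated S \<Longrightarrow> \<pi> permutes {..<n} \<Longrightarrow> \<sigma> permutes {..<n}
      \<Longrightarrow> (n, on_bits n (\<lambda>x. permute_list \<sigma> (F (permute_list \<pi> x)))) \<in> generated S"
| extension:
    "(n, F) \<in> generated S
      \<Longrightarrow> (n + 1, on_bits (n + 1) (\<lambda>x. F (butlast x) @ [last x])) \<in> generated S"
| ancilla:
    "(n + k, F) \<in> generated S \<Longrightarrow> a \<in> bitstrings k \<Longrightarrow> (n, G) \<in> reversible_gates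
      \<Longrightarrow> (\<And>x. x \<in> bitstrings n \<Longrightarrow> F (x @ a) = G x @ a) \<Longrightarrow> (n, G) \<in> generated S"

definition reversible_gate_class :: "gate set \<Rightarrow> bool" where
  "reversible_gate_class C \<longleftrightarrow> (\<exists>S. S \<subseteq> reversible_gates \<and> C = generated S)"

definition dual :: "nat \<Rightarrow> (bool list \<Rightarrow> bool list) \<Rightarrow> bool list \<Rightarrow> bool list" where
  "dual n F = on_bits n (\<lambda>x. map Not (F (map Not x)))"

lemma on_bits_permutes:
  assumes "\<And>x. length x = n \<Longrightarrow> length (f x) = n"
    and "\<And>x y. length x = n \<Longrightarrow> length y = n \<Longrightarrow> f x = f y \<Longrightarrow> x = y"
  shows "on_bits n f permutes bitstrings n"
proof (rule bij_imp_permutes)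
  have fin: "finite (bitstrings n)"
    using finite_lists_length_eq[of "UNIV :: bool set" n] by (simp add: bitstrings_def)
  have "inj_on (on_bits n f) (bitstrings n)"
    using assms(2) by (auto simp: inj_on_def bitstrings_def on_bits_def)
  moreover have "on_bits n f ` bitstrings n \<subseteq> bitstrings n"
    using assms(1) by (auto simp: bitstrings_def on_bits_def)
  ultimately show "bij_betw (on_bits n f) (bitstrings n) (bitstrings n)"
    using endo_inj_surj[OF fin] by (simp add: bij_betw_def)
qed (simp add: bitstrings_def on_bits_def)

lemma length_gate:
  assumes "F permutes bitstrings n" "length x = n"
  shows "length (F x) = n"
  using permutes_in_image[OF assms(1), of x] assms(2) by (simp add: bitstrings_def)

lemma permute_list_inj:
  assumes p: "p permutes {..<n}" and len: "length x = n" "length y = n"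
    and eq: "permute_list p x = permute_list p y"
  shows "x = y"
proof (rule nth_equalityI)
  fix i assume "i < length x"
  then have "i \<in> p ` {..<n}" using permutes_image[OF p] len by simp
  then obtain j where "j < n" "i = p j" by auto
  then show "x ! i = y ! i"
    using permute_list_nth[of p x j] permute_list_nth[of p y j] p len eq by simp
qed (simp add: len)

lemma generated_reversible:
  assumes "S \<subseteq> reversible_gates"
  shows "generated S \<subseteq> reversible_gates"
proof
  fix g assume "g \<in> generated S"
  then show "g \<in> reversible_gates"
  proof induction
    case (base g)
    then show ?case using assms by auto
  next
    case (identity n)
    then show ?case by (simp add: reversible_gates_def permutes_id)
  next
    case (composition n F G)
    then show ?case by (simp add: reversible_gates_def permutes_compose)
  next
    case (permutation n F p q)
    then have F: "F permutes bitstrings n" and n: "1 \<le> n" by (auto simp: reversible_gates_def)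
    have "on_bits n (\<lambda>x. permute_list q (F (permute_list p x))) permutes bitstrings n"
    proof (rule on_bits_permutes)
      fix x y :: "bool list"
      assume l: "length x = n" "length y = n"
        and e: "permute_list q (F (permute_list p x)) = permute_list q (F (permute_list p y))"
      have "F (permute_list p x) = F (permute_list p y)"
        by (rule permute_list_inj[OF permutation.hyps(3) _ _ e]) (simp_all add: length_gate[OF F] l)
      then have "permute_list p x = permute_list p y"
        by (rule injD[OF permutes_inj[OF F]])
      then show "x = y" by (rule permute_list_inj[OF permutation.hyps(2) l])
    qed (simp add: length_gate[OF F])
    then show ?case using n by (simp add: reversible_gates_def)
  next
    case (extension n F)
    then have F: "F permutes bitstrings n" by (auto simp: reversible_gates_def)
    have "on_bits (n + 1) (\<lambda>x. F (butlast x) @ [last x]) permutes bitstrings (n + 1)"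
    proof (rule on_bits_permutes)
      fix x y :: "bool list"
      assume l: "length x = n + 1" "length y = n + 1"
        and e: "F (butlast x) @ [last x] = F (butlast y) @ [last y]"
      then have "butlast x = butlast y" "last x = last y"
        by (simp_all add: inj_eq[OF permutes_inj[OF F]])
      then have "butlast x @ [last x] = butlast y @ [last y]" by (simp only:)
      moreover have "x \<noteq> []" "y \<noteq> []" using l by auto
      ultimately show "x = y" by simp
    qed (simp add: length_gate[OF F])
    then show ?case by (simp add: reversible_gates_def)
  next
    case (ancilla n k F a G)
    then show ?case by simp
  qed
qed

lemma dual_reversible:
  assumes "(n, F) \<in> reversible_gates"
  shows "(n, dual n F) \<in> reversible_gates"
proof -
  have F: "F permutes bitstrings n" and n: "1 \<le> n"
    using assms by (auto simp: reversible_gates_def)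
  have inj_Not: "inj (map Not)" by (rule inj_mapI) (simp add: inj_def)
  have "dual n F permutes bitstrings n"
    unfolding dual_def
    by (rule on_bits_permutes) (auto simp: length_gate[OF F] inj_eq[OF inj_Not] inj_eq[OF permutes_inj[OF F]])
  then show ?thesis using n by (simp add: reversible_gates_def)
qed

end

theory Submission
  imports Defs
begin

text \<open>
  Think of a circuit as acting on a multiset of wires, each carrying a Boolean function of the
  input. Write \<open>A \<sim> B\<close> if gates of \<open>C\<close> together with constant ancillas turn \<open>A\<close> into \<open>B\<close>;
  this is a congruence in which constants cancel. With \<open>x\<close> the input wires and \<open>z\<close> the wires of
  the dual output, the gate \<open>F\<close> itself gives \<open>\<not>x \<sim> \<not>z\<close>, and the task is \<open>x \<sim> z\<close>.

  Feeding a gate with wires that are all copies of \<open>b\<close>, of \<open>\<not>b\<close>, or constant (i.e. letting \<open>b\<close>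
  choose between two inputs \<open>p\<close> and \<open>q\<close>) yields, modulo constants, relations
  \<open>i b + j \<not>b \<sim> i' b + j' \<not>b\<close> valid for every \<open>b\<close>. The differences \<open>j - j'\<close> form a subgroup of
  the integers. If it were contained in a proper subgroup, some modulus would divide all changes
  of \<open>#{k. p\<^sub>k \<and> \<not> q\<^sub>k}\<close> under \<open>F\<close>; that is, \<open>F(p) \<bullet> F\<^sup>*(q) = p \<bullet> q\<close> for that modulus, which
  forces \<open>F\<^sup>* = F\<close>. Otherwise there is a relation \<open>a b + (j + 1) \<not>b \<sim> c b + j \<not>b\<close>, and applying it to
  the wires of \<open>\<not>x\<close> and, reversed, to those of \<open>\<not>z\<close> gives \<open>x + D \<sim> z + D\<close> for a catalyst \<open>D\<close>
  built from \<open>x, \<not>x, z, \<not>z\<close>.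

  The catalyst is removed with a relation \<open>b \<sim> b + T (b + \<not>b)\<close> with \<open>T\<close> large, by which both \<open>x\<close>
  and \<open>z\<close> can create \<open>D\<close> from constants. It exists because a gate that is not self-dual is not an
  isometry of the hypercube, so \<open>b\<close> can be multiplied, and not an order automorphism of it, so
  some gate of \<open>C\<close> turns copies of \<open>b\<close> into copies of \<open>\<not>b\<close>.
\<close>

subsection \<open>Columns and pairs of inputs\<close>

type_synonym column = "bool list \<Rightarrow> bool"

definition row :: "column list \<Rightarrow> bool list \<Rightarrow> bool list" where
  "row cs \<rho> = map (\<lambda>c. c \<rho>) cs"

definition neg :: "column \<Rightarrow> column" where
  "neg c = (\<lambda>\<rho>. \<not> c \<rho>)"

definition const :: "bool \<Rightarrow> column" where
  "const v = (\<lambda>_. v)"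

definition constants :: "column multiset \<Rightarrow> bool" where
  "constants K \<longleftrightarrow> set_mset K \<subseteq> range const"

definition mix :: "column \<Rightarrow> nat \<Rightarrow> nat \<Rightarrow> column multiset" where
  "mix b i j = replicate_mset i b + replicate_mset j (neg b)"

text \<open>The number \<open>pairs True False p q\<close> is the inner product of \<open>p\<close>
  with the complement of \<open>q\<close>. It counts the wires carrying \<open>neg b\<close> when
  \<open>b\<close> switches from \<open>p\<close> (false) to \<open>q\<close> (true).\<close>

definition pairs :: "bool \<Rightarrow> bool \<Rightarrow> bool list \<Rightarrow> bool list \<Rightarrow> nat" where
  "pairs u v p q = card {i. i < length p \<and> p ! i = u \<and> q ! i = v}"

lemma length_row [simp]: "length (row cs \<rho>) = length cs"
  by (simp add: row_def)

lemma row_append [simp]: "row (cs @ ds) \<rho> = row cs \<rho> @ row ds \<rho>"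
  by (simp add: row_def)

lemma neg_neg [simp]: "neg (neg b) = b"
  by (simp add: neg_def)

lemma constants_add [simp]: "constants (K + L) \<longleftrightarrow> constants K \<and> constants L"
  by (simp add: constants_def)

lemma constants_empty [simp]: "constants {#}"
  by (simp add: constants_def)

lemma constants_repeat: "constants K \<Longrightarrow> constants (repeat_mset m K)"
  by (induction m) simp_all

lemma constants_replicate: "constants (replicate_mset m (const v))"
  by (induction m) (simp_all add: constants_def)

lemma mix_add: "mix b i j + mix b i' j' = mix b (i + i') (j + j')"
  by (simp add: mix_def multiset_eq_iff)

lemma mix_neg: "mix (neg b) i j = mix b j i"
  by (simp add: mix_def add.commute)

text \<open>A selected wire is constant where \<open>p\<close> and \<open>q\<close> agree; elsewhere
  it carries \<open>b\<close> or \<open>neg b\<close>, according to the direction of the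
  change.\<close>

lemma mset_select:
  assumes "length p = length q"
  shows "mset (map2 (\<lambda>u v \<rho>. if b \<rho> then v else u) p q) =
    mix b (pairs False True p q) (pairs True False p q) +
    (replicate_mset (pairs False False p q) (const False) +
     replicate_mset (pairs True True p q) (const True))"
proof -
  have pairs: "pairs u v p q = count_list (zip p q) (u, v)" if "length p = length q" for u v p q
    using that by (auto simp: pairs_def count_list_eq_length_filter length_filter_conv_card
        intro!: arg_cong[where f = card])
  have sel: "(\<lambda>\<rho>. if b \<rho> then v else u) =
    (if u = v then const u else if v then b else neg b)" for u v
    by (auto simp: const_def neg_def fun_eq_iff)
  show ?thesis
    unfolding pairs[OF assms] sel using assms
    by (induction p q rule: list_induct2) (auto simp: mix_def)
qed

lemma pairs_split:
  assumes "length p = n" "length q = n"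
  shows "pairs True False p q + pairs True False p (map Not q) = card {i. i < n \<and> p ! i}"
proof -
  let ?A = "{i. i < n \<and> p ! i = True \<and> q ! i = False}"
  let ?B = "{i. i < n \<and> p ! i = True \<and> map Not q ! i = False}"
  have "{i. i < n \<and> p ! i} = ?A \<union> ?B" using assms by auto
  moreover have "card (?A \<union> ?B) = card ?A + card ?B"
    using assms by (intro card_Un_disjoint) auto
  ultimately show ?thesis by (simp only: pairs_def assms(1))
qed

section \<open>Hamming distance\<close>

definition hamming :: "bool list \<Rightarrow> bool list \<Rightarrow> nat" where
  "hamming p q = card {i. i < length p \<and> p ! i \<noteq> q ! i}"

lemma hamming_pairs: "hamming p q = pairs False True p q + pairs True False p q"
proof -
  have "{i. i < length p \<and> p ! i \<noteq> q ! i} =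
    {i. i < length p \<and> p ! i = False \<and> q ! i = True} \<union> {i. i < length p \<and> p ! i = True \<and> q ! i = False}"
    by auto
  then show ?thesis
    unfolding hamming_def pairs_def by (subst card_Un_disjoint[symmetric]) auto
qed

lemma hamming_sym: "length p = length q \<Longrightarrow> hamming p q = hamming q p"
  by (simp add: hamming_def eq_commute)

lemma hamming_triangle:
  assumes "length p = length q" "length q = length r"
  shows "hamming p r \<le> hamming p q + hamming q r"
proof -
  have "hamming p r \<le> card ({i. i < length p \<and> p ! i \<noteq> q ! i} \<union> {i. i < length q \<and> q ! i \<noteq> r ! i})"
    unfolding hamming_def using assms by (intro card_mono) auto
  also have "\<dots> \<le> hamming p q + hamming q r"
    unfolding hamming_def by (rule card_Un_le)
  finally show ?thesis .
qed

text \<open>Walk from \<open>p\<close> to \<open>q\<close>, correcting one differing bit at a time,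
  and apply the triangle inequality.\<close>

lemma hamming_lipschitz:
  assumes len: "\<And>p. length p = n \<Longrightarrow> length (G p) = n"
    and step: "\<And>p i. length p = n \<Longrightarrow> i < n \<Longrightarrow> \<not> p ! i \<Longrightarrow> hamming (G p) (G (p[i := True])) \<le> 1"
    and "length p = n" "length q = n"
  shows "hamming (G p) (G q) \<le> hamming p q"
  using assms(3)
proof (induction "hamming p q" arbitrary: p)
  case 0
  then have "p = q"
    using assms(4) by (intro nth_equalityI) (auto simp: hamming_def)
  then show ?case by (simp add: hamming_def)
next
  case (Suc k)
  then have "{i. i < length p \<and> p ! i \<noteq> q ! i} \<noteq> {}"
    unfolding hamming_def by (metis card.empty nat.distinct(1))
  then obtain i where i: "i < n" "p ! i \<noteq> q ! i" using Suc.prems by auto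
  define p' where "p' = p[i := q ! i]"
  have p': "length p' = n" using Suc.prems by (simp add: p'_def)
  have "{j. j < length p' \<and> p' ! j \<noteq> q ! j} = {j. j < length p \<and> p ! j \<noteq> q ! j} - {i}"
    using i Suc.prems by (auto simp: p'_def nth_list_update)
  then have "hamming p' q = k"
    using Suc.hyps(2) i Suc.prems by (simp add: hamming_def)
  then have IH: "hamming (G p') (G q) \<le> k" using Suc.hyps(1) p' by metis
  have "hamming (G p) (G p') \<le> 1"
  proof (cases "p ! i")
    \<comment> \<open>A downward flip is an upward flip of \<open>p'\<close> read backwards, so the
      symmetry of the distance reduces it to \<open>step\<close>.\<close>
    case True
    then have "p'[i := True] = p" "\<not> p' ! i"
      using i Suc.prems by (auto simp: p'_def list_update_same_conv)
    then show ?thesis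
      using step[of p' i] p' i Suc.prems by (simp add: hamming_sym len)
  next
    case False
    then show ?thesis using step[of p i] i Suc.prems by (simp add: p'_def)
  qed
  moreover have "hamming (G p) (G q) \<le> hamming (G p) (G p') + hamming (G p') (G q)"
    by (rule hamming_triangle) (simp_all add: len Suc.prems p' assms(4))
  ultimately show ?case using IH Suc.hyps(2) by simp
qed

subsection \<open>Criteria for self-duality\<close>

definition self_dual :: "nat \<Rightarrow> (bool list \<Rightarrow> bool list) \<Rightarrow> bool" where
  "self_dual n F \<longleftrightarrow> (\<forall>x. length x = n \<longrightarrow> F (map Not x) = map Not (F x))"

lemma dual_self_dual:
  assumes "F permutes bitstrings n" "self_dual n F"
  shows "dual n F = F"
proof
  fix x
  show "dual n F x = F x"
  proof (cases "length x = n")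
    case True
    then show ?thesis using assms(2) by (simp add: dual_def on_bits_def self_dual_def o_def)
  next
    case False
    then show ?thesis
      using permutes_not_in[OF assms(1), of x] by (simp add: dual_def on_bits_def bitstrings_def)
  qed
qed

lemma preimage_gate:
  assumes "F permutes bitstrings n" "length y = n"
  obtains x where "length x = n" "F x = y"
  using length_gate[OF permutes_inv[OF assms(1)] assms(2)] permutes_inverses(1)[OF assms(1)] by blast

text \<open>
  Choosing \<open>p\<close> with \<open>F p\<close> the \<open>i\<close>-th unit vector expresses \<open>\<not> F(q)\<^sub>i\<close> as \<open>p \<bullet> \<not>q\<close> modulo \<open>m\<close>, so its
  sum with \<open>\<not> F(\<not>q)\<^sub>i\<close> is independent of \<open>q\<close>; the value \<open>1\<close> of that sum comes from \<open>q = 0\<close>.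
\<close>

lemma self_dual_if_congruent:
  fixes m :: int
  assumes F: "F permutes bitstrings n" and m: "2 \<le> m"
    and cong: "\<And>p q. length p = n \<Longrightarrow> length q = n \<Longrightarrow>
      m dvd int (pairs True False (F p) (F q)) - int (pairs True False p q)"
  shows "self_dual n F"
proof -
  note len = length_gate[OF F]
  have small: "\<not> m dvd 1" using m zdvd_imp_le[of m 1] by auto
  have "F (map Not q) ! i = (\<not> F q ! i)" if q: "length q = n" and i: "i < n" for q i
  proof -
    let ?d = "\<lambda>y. if y ! i then 0 else 1 :: int"
    obtain p where p: "length p = n" "F p = (replicate n False)[i := True]"
      using preimage_gate[OF F] by (metis length_list_update length_replicate)
    have Fp: "int (pairs True False (F p) y) = ?d y" if "length y = n" for y
    proof -
      have "{j. j < n \<and> F p ! j = True \<and> y ! j = False} = (if y ! i then {} else {i})"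
        using i by (auto simp: p nth_list_update split: if_splits)
      then show ?thesis by (simp add: pairs_def p)
    qed
    have d: "m dvd ?d (F y) - int (pairs True False p y)" if "length y = n" for y
      using cong[OF p(1) that] Fp[of "F y"] len that by simp
    \<comment> \<open>Otherwise the pair of the zero string and the preimage of the complement of
      the unit vector would change its count from 0 to 1.\<close>
    have zero: "\<not> F (replicate n False) ! i"
    proof
      assume a: "F (replicate n False) ! i"
      obtain r where r: "length r = n" "F r = (replicate n True)[i := False]"
        using preimage_gate[OF F] by (metis length_list_update length_replicate)
      have "{j. j < n \<and> F (replicate n False) ! j = True \<and> F r ! j = False} = {i}"
        using i a by (auto simp: r nth_list_update split: if_splits)
      then have "pairs True False (F (replicate n False)) (F r) = 1"
        using len by (simp add: pairs_def)
      moreover have "pairs True False (replicate n False) r = 0"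
        by (auto simp: pairs_def)
      ultimately show False using cong[of "replicate n False" r] r small by simp
    qed
    define c where "c = int (card {j. j < n \<and> p ! j})"
    have "pairs True False p (replicate n False) = card {j. j < n \<and> p ! j}"
      unfolding pairs_def using p(1) by (intro arg_cong[where f = card]) auto
    with d[of "replicate n False"] zero have c: "m dvd 1 - c" by (simp add: c_def)
    have "m dvd (?d (F q) - int (pairs True False p q)) +
        (?d (F (map Not q)) - int (pairs True False p (map Not q)))"
      using q by (intro dvd_add d) simp_all
    also have "\<dots> = ?d (F q) + ?d (F (map Not q)) - c"
      using pairs_split[OF p(1) q] by (simp add: c_def flip: of_nat_add)
    finally have "m dvd (?d (F q) + ?d (F (map Not q)) - c) - (1 - c)"
      using c by (rule dvd_diff)
    moreover have "x + y - c - (1 - c) = x + y - 1" for x y :: int by simp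
    ultimately have sum: "m dvd ?d (F q) + ?d (F (map Not q)) - 1" by (simp only:)
    show ?thesis
    proof (rule ccontr)
      assume "F (map Not q) ! i \<noteq> (\<not> F q ! i)"
      \<comment> \<open>Two equal bits give 0 or 2 for the sum of the complements, hence a number
        next to 0 that \<open>m\<close> cannot divide.\<close>
      then have "?d (F q) + ?d (F (map Not q)) - 1 \<in> {1, - 1}" by auto
      then show False using sum small by auto
    qed
  qed
  then have "F (map Not q) = map Not (F q)" if "length q = n" for q
    using that by (intro nth_equalityI) (simp_all add: len)
  then show ?thesis by (simp add: self_dual_def)
qed

text \<open>Such an \<open>F\<close> is an order automorphism of a Boolean lattice. It preserves
  bottom, top, meets and joins, and complements are determined by these.\<close>

lemma self_dual_if_monotone:
  assumes F: "F permutes bitstrings n"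
    and mono: "\<And>p q. list_all2 (\<le>) p q \<Longrightarrow> length q = n \<Longrightarrow> list_all2 (\<le>) (F p) (F q)"
    and mono': "\<And>p q. list_all2 (\<le>) p q \<Longrightarrow> length q = n \<Longrightarrow> list_all2 (\<le>) (inv F p) (inv F q)"
  shows "self_dual n F"
proof -
  note len = length_gate[OF F] length_gate[OF permutes_inv[OF F]]
  note inv = permutes_inverses[OF F]
  \<comment> \<open>A common lower bound of the two images pulls back along \<open>inv F\<close> to
    a common lower bound of complementary strings, which is bottom.\<close>
  have below: "y = F (replicate n False)"
    if "length x = n" "list_all2 (\<le>) y (F x)" "list_all2 (\<le>) y (F (map Not x))" for x y
  proof -
    have "list_all2 (\<le>) (inv F y) x" "list_all2 (\<le>) (inv F y) (map Not x)"
      using mono'[OF that(2)] mono'[OF that(3)] that(1) by (simp_all add: len inv)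
    then have "inv F y = replicate n False"
      using that(1) by (intro nth_equalityI) (auto simp: list_all2_conv_all_nth)
    then show ?thesis by (metis inv(1))
  qed
  have above: "y = F (replicate n True)"
    if "length x = n" "list_all2 (\<le>) (F x) y" "list_all2 (\<le>) (F (map Not x)) y" for x y
  proof -
    have "length y = n" using that by (auto simp: list_all2_conv_all_nth len)
    then have "list_all2 (\<le>) x (inv F y)" "list_all2 (\<le>) (map Not x) (inv F y)"
      using mono'[OF that(2)] mono'[OF that(3)] that(1) by (simp_all add: len inv)
    then have "inv F y = replicate n True"
      using that(1) by (intro nth_equalityI) (auto simp: list_all2_conv_all_nth)
    then show ?thesis by (metis inv(1))
  qed
  have least: "list_all2 (\<le>) (F (replicate n False)) y" if "length y = n" for y
    using mono[of "replicate n False" "inv F y"] that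
    by (simp add: list_all2_conv_all_nth len inv)
  have greatest: "list_all2 (\<le>) y (F (replicate n True))" if "length y = n" for y
    using mono[of "inv F y" "replicate n True"] that
    by (simp add: list_all2_conv_all_nth len inv)
  have bot: "F (replicate n False) = replicate n False"
    using least[of "replicate n False"] by (intro nth_equalityI) (auto simp: list_all2_conv_all_nth len)
  have top: "F (replicate n True) = replicate n True"
    using greatest[of "replicate n True"] by (intro nth_equalityI) (auto simp: list_all2_conv_all_nth len)
  have "F (map Not x) = map Not (F x)" if x: "length x = n" for x
  proof (rule nth_equalityI)
    fix i assume "i < length (F (map Not x))"
    then have i: "i < n" using x by (simp add: len)
    have "map2 (\<and>) (F x) (F (map Not x)) = replicate n False"
      using below[OF x, of "map2 (\<and>) (F x) (F (map Not x))"] x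
      by (auto simp: list_all2_conv_all_nth len bot)
    then have "map2 (\<and>) (F x) (F (map Not x)) ! i = replicate n False ! i" by simp
    moreover have "map2 (\<or>) (F x) (F (map Not x)) = replicate n True"
      using above[OF x, of "map2 (\<or>) (F x) (F (map Not x))"] x
      by (auto simp: list_all2_conv_all_nth len top)
    then have "map2 (\<or>) (F x) (F (map Not x)) ! i = replicate n True ! i" by simp
    ultimately show "F (map Not x) ! i = map Not (F x) ! i"
      using i x by (auto simp: len)
  qed (simp add: len x)
  then show ?thesis by (simp add: self_dual_def)
qed

text \<open>A subgroup of the integers consists of the multiples of its least positive element,
  which is not 1 here. For the trivial subgroup the modulus 2 will do.\<close>

lemma int_subgroup_dvd:
  fixes J :: "int set"
  assumes zero: "0 \<in> J" and diff: "\<And>x y. x \<in> J \<Longrightarrow> y \<in> J \<Longrightarrow> x - y \<in> J" and "1 \<notin> J"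
  obtains m where "2 \<le> m" "\<And>x. x \<in> J \<Longrightarrow> m dvd x"
proof (cases "J \<subseteq> {0}")
  case True
  then show thesis using that[of 2] by auto
next
  case False
  have minus: "- x \<in> J" if "x \<in> J" for x using diff[OF zero that] by simp
  have add: "x + y \<in> J" if "x \<in> J" "y \<in> J" for x y
    using diff[OF that(1) minus[OF that(2)]] by simp
  obtain x where "x \<in> J" "0 < x" using False minus by (metis insertCI neg_0_less_iff_less not_less_iff_gr_or_eq subsetI)
  then have ex: "0 < int (nat x) \<and> int (nat x) \<in> J" by simp
  define k where "k = (LEAST k. 0 < int k \<and> int k \<in> J)"
  have k: "0 < int k" "int k \<in> J"
    using LeastI[where P = "\<lambda>k. 0 < int k \<and> int k \<in> J", OF ex] by (simp_all add: k_def)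
  have least: "\<not> (0 < int l \<and> int l \<in> J)" if "l < k" for l
    using not_less_Least that unfolding k_def by blast
  have mult_nat: "int l * int k \<in> J" for l
    by (induction l) (simp_all add: zero add k algebra_simps)
  have mult: "l * int k \<in> J" for l
  proof (cases "0 \<le> l")
    case True
    then show ?thesis using mult_nat[of "nat l"] by simp
  next
    case False
    then show ?thesis using minus[OF mult_nat[of "nat (- l)"]] by simp
  qed
  have "int k dvd y" if "y \<in> J" for y
  proof (rule ccontr)
    assume "\<not> int k dvd y"
    then have pos: "0 < y mod int k"
      using k(1) by (metis dvd_eq_mod_eq_0 order_le_less pos_mod_sign)
    have "y - (y div int k) * int k \<in> J" by (rule diff[OF that mult])
    then have "int (nat (y mod int k)) \<in> J" using pos by (simp add: minus_div_mult_eq_mod)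
    moreover have "nat (y mod int k) < k" using k(1) pos_mod_bound[of "int k" y] by linarith
    ultimately show False using least[of "nat (y mod int k)"] pos by simp
  qed
  moreover have "2 \<le> int k"
  proof (rule ccontr)
    assume "\<not> 2 \<le> int k"
    then have "int k = 1" using k(1) by linarith
    then show False using k(2) assms(3) by simp
  qed
  ultimately show thesis using that by blast
qed

subsection \<open>Transformations of multisets of columns\<close>

locale gate_class =
  fixes C :: "gate set"
  assumes gate_class: "reversible_gate_class C"
begin

lemma
  shows identity: "1 \<le> n \<Longrightarrow> (n, id) \<in> C"
    and composition: "(n, F) \<in> C \<Longrightarrow> (n, G) \<in> C \<Longrightarrow> (n, F \<circ> G) \<in> C"
    and permutation: "(n, F) \<in> C \<Longrightarrow> \<pi> permutes {..<n} \<Longrightarrow> \<sigma> permutes {..<n}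
      \<Longrightarrow> (n, on_bits n (\<lambda>x. permute_list \<sigma> (F (permute_list \<pi> x)))) \<in> C"
    and extension: "(n, F) \<in> C \<Longrightarrow> (n + 1, on_bits (n + 1) (\<lambda>x. F (butlast x) @ [last x])) \<in> C"
    and ancilla: "(n + k, F) \<in> C \<Longrightarrow> a \<in> bitstrings k \<Longrightarrow> (n, G) \<in> reversible_gates
      \<Longrightarrow> (\<And>x. x \<in> bitstrings n \<Longrightarrow> F (x @ a) = G x @ a) \<Longrightarrow> (n, G) \<in> C"
proof -
  obtain S where C: "C = generated S"
    using gate_class by (auto simp: reversible_gate_class_def)
  show "1 \<le> n \<Longrightarrow> (n, id) \<in> C"
    unfolding C by (rule generated.identity)
  show "(n, F) \<in> C \<Longrightarrow> (n, G) \<in> C \<Longrightarrow> (n, F \<circ> G) \<in> C"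
    unfolding C by (rule generated.composition)
  show "(n, F) \<in> C \<Longrightarrow> \<pi> permutes {..<n} \<Longrightarrow> \<sigma> permutes {..<n}
      \<Longrightarrow> (n, on_bits n (\<lambda>x. permute_list \<sigma> (F (permute_list \<pi> x)))) \<in> C"
    unfolding C by (rule generated.permutation)
  show "(n, F) \<in> C \<Longrightarrow> (n + 1, on_bits (n + 1) (\<lambda>x. F (butlast x) @ [last x])) \<in> C"
    unfolding C by (rule generated.extension)
  show "(n + k, F) \<in> C \<Longrightarrow> a \<in> bitstrings k \<Longrightarrow> (n, G) \<in> reversible_gates
      \<Longrightarrow> (\<And>x. x \<in> bitstrings n \<Longrightarrow> F (x @ a) = G x @ a) \<Longrightarrow> (n, G) \<in> C"
    unfolding C by (rule generated.ancilla)
qed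

lemma reversible: "(n, F) \<in> C \<Longrightarrow> (n, F) \<in> reversible_gates"
  using gate_class generated_reversible unfolding reversible_gate_class_def by blast

lemma permutes: "(n, F) \<in> C \<Longrightarrow> F permutes bitstrings n"
  and positive: "(n, F) \<in> C \<Longrightarrow> 1 \<le> n"
  using reversible by (auto simp: reversible_gates_def)

text \<open>A permutation of a finite set has finite order, so its inverse is one of its powers and
  is reached by composition.\<close>

lemma inverse:
  assumes "(n, F) \<in> C"
  shows "(n, inv F) \<in> C"
proof -
  have pow: "(n, F ^^ k) \<in> C" for k
    by (induction k) (simp_all only: funpow.simps identity[OF positive[OF assms]] composition[OF assms])
  have "finite (bitstrings n)"
    using finite_lists_length_eq[of "UNIV :: bool set" n] by (simp add: bitstrings_def)
  then have "permutation F"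
    using permutes[OF assms] by (auto simp: permutation_permutes)
  then obtain k where k: "F ^^ k = id" "0 < k"
    using permutation_is_nilpotent by blast
  then obtain l where "k = Suc l" by (cases k) auto
  with k have "F \<circ> F ^^ l = id" by simp
  then have "inv F \<circ> (F \<circ> F ^^ l) = inv F" by simp
  then have "inv F = F ^^ l"
    by (simp add: o_assoc permutes_inv_o(2)[OF permutes[OF assms]])
  then show ?thesis using pow by simp
qed

definition maps :: "column list \<Rightarrow> column list \<Rightarrow> bool" where
  "maps cs ds \<longleftrightarrow> (\<exists>F. (length cs, F) \<in> C \<and> (\<forall>\<rho>. F (row cs \<rho>) = row ds \<rho>))"

lemma maps_length: "maps cs ds \<Longrightarrow> length ds = length cs"
  unfolding maps_def by (metis length_gate length_row permutes)

lemma maps_refl: "cs \<noteq> [] \<Longrightarrow> maps cs cs"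
  using identity[of "length cs"] unfolding maps_def by (auto simp: Suc_le_eq)

lemma maps_sym:
  assumes "maps cs ds"
  shows "maps ds cs"
proof -
  obtain F where F: "(length cs, F) \<in> C" "\<And>\<rho>. F (row cs \<rho>) = row ds \<rho>"
    using assms by (auto simp: maps_def)
  then have "inv F (row ds \<rho>) = row cs \<rho>" for \<rho>
    by (metis permutes permutes_inverses(2))
  then show ?thesis
    using inverse[OF F(1)] maps_length[OF assms] unfolding maps_def by metis
qed

lemma maps_trans:
  assumes "maps cs ds" "maps ds es"
  shows "maps cs es"
proof -
  obtain F G where "(length cs, F) \<in> C" "\<And>\<rho>. F (row cs \<rho>) = row ds \<rho>"
    and "(length ds, G) \<in> C" "\<And>\<rho>. G (row ds \<rho>) = row es \<rho>"
    using assms by (auto simp: maps_def)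
  then show ?thesis
    using composition[of "length cs" G F] maps_length[OF assms(1)]
    unfolding maps_def by (intro exI[of _ "G \<circ> F"]) simp
qed

lemma maps_append:
  assumes "maps cs ds"
  shows "maps (cs @ es) (ds @ es)"
proof (induction es rule: rev_induct)
  case Nil
  then show ?case using assms by simp
next
  case (snoc e es)
  then obtain F where F: "(length (cs @ es), F) \<in> C" "\<And>\<rho>. F (row (cs @ es) \<rho>) = row (ds @ es) \<rho>"
    unfolding maps_def by blast
  have last: "row [e] \<rho> = [e \<rho>]" for \<rho> by (simp add: row_def)
  let ?G = "on_bits (length (cs @ es) + 1) (\<lambda>x. F (butlast x) @ [last x])"
  have "?G (row (cs @ es @ [e]) \<rho>) = row (ds @ es @ [e]) \<rho>" for \<rho>
    using F(2)[of \<rho>] by (simp add: on_bits_def last butlast_append)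
  then show ?case
    using extension[OF F(1)] unfolding maps_def by (intro exI[of _ ?G]) simp
qed

text \<open>The order of the wires is immaterial on both sides, which justifies the passage to
  multisets.\<close>

lemma maps_permute:
  assumes "maps cs ds" "mset cs' = mset cs" "mset ds' = mset ds"
  shows "maps cs' ds'"
proof -
  obtain F where F: "(length cs, F) \<in> C" "\<And>\<rho>. F (row cs \<rho>) = row ds \<rho>"
    using assms by (auto simp: maps_def)
  have len: "length cs' = length cs" "length ds = length cs"
    using assms(2) maps_length[OF assms(1)] by (metis size_mset)+
  obtain \<pi> where \<pi>: "\<pi> permutes {..<length cs}" "permute_list \<pi> cs' = cs"
    using mset_eq_permutation[OF assms(2)[symmetric]] len by metis
  obtain \<sigma> where \<sigma>: "\<sigma> permutes {..<length cs}" "permute_list \<sigma> ds = ds'"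
    using mset_eq_permutation[OF assms(3)] len by metis
  let ?G = "on_bits (length cs) (\<lambda>x. permute_list \<sigma> (F (permute_list \<pi> x)))"
  have "?G (row cs' \<rho>) = row ds' \<rho>" for \<rho>
  proof -
    have "permute_list \<pi> (row cs' \<rho>) = row cs \<rho>"
      unfolding row_def using \<pi> len by (subst permute_list_map) simp_all
    moreover have "permute_list \<sigma> (row ds \<rho>) = row ds' \<rho>"
      unfolding row_def using \<sigma> len by (subst permute_list_map) simp_all
    ultimately show ?thesis using F(2) len by (simp add: on_bits_def)
  qed
  then show ?thesis
    using permutation[OF F(1) \<pi>(1) \<sigma>(1)] len unfolding maps_def by metis
qed

text \<open>The constants \<open>K\<close> are ancillas: borrowed and returned unchanged as a
  multiset.\<close>

definition sim :: "column multiset \<Rightarrow> column multiset \<Rightarrow> bool" (infix "\<sim>" 50) where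
  "A \<sim> B \<longleftrightarrow> (\<exists>cs ds K. constants K \<and> mset cs = A + K \<and> mset ds = B + K \<and> maps cs ds)"

lemma simI: "maps cs ds \<Longrightarrow> mset cs \<sim> mset ds"
  unfolding sim_def by (intro exI[of _ cs] exI[of _ ds] exI[of _ "{#}"]) simp

lemma sim_refl [simp]: "A \<sim> A"
proof -
  \<comment> \<open>The extra constant wire covers empty \<open>A\<close>, since there is no gate on
    zero bits.\<close>
  obtain cs where cs: "mset cs = A + {#const False#}" using ex_mset by blast
  then have "cs \<noteq> []" by auto
  then have "maps cs cs" by (rule maps_refl)
  moreover have "constants {#const False#}" by (simp add: constants_def)
  ultimately show ?thesis unfolding sim_def using cs by blast
qed

lemma sim_sym: "A \<sim> B \<Longrightarrow> B \<sim> A"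
  unfolding sim_def using maps_sym by blast

lemma sim_add_right:
  assumes "A \<sim> B"
  shows "A + D \<sim> B + D"
proof -
  obtain cs ds K where *: "constants K" "mset cs = A + K" "mset ds = B + K" "maps cs ds"
    using assms by (auto simp: sim_def)
  obtain es where "mset es = D" using ex_mset by blast
  then show ?thesis
    unfolding sim_def using * maps_append[OF *(4), of es]
    by (intro exI[of _ "cs @ es"] exI[of _ "ds @ es"] exI[of _ K]) simp
qed

text \<open>The ancillas \<open>L\<close> idle during the first circuit and \<open>K\<close> during
  the second.\<close>

lemma sim_trans [trans]:
  assumes "A \<sim> B" "B \<sim> D"
  shows "A \<sim> D"
proof -
  obtain cs ds K where 1: "constants K" "mset cs = A + K" "mset ds = B + K" "maps cs ds"
    using assms by (auto simp: sim_def)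
  obtain ds' es L where 2: "constants L" "mset ds' = B + L" "mset es = D + L" "maps ds' es"
    using assms by (auto simp: sim_def)
  obtain ks ls where 3: "mset ks = K" "mset ls = L" using ex_mset by blast
  have "maps (cs @ ls) (ds @ ls)" by (rule maps_append[OF 1(4)])
  moreover have "maps (ds @ ls) (es @ ks)"
    by (rule maps_permute[OF maps_append[OF 2(4), of ks]]) (simp_all add: 1 2 3)
  ultimately have "maps (cs @ ls) (es @ ks)" by (rule maps_trans)
  then show ?thesis
    unfolding sim_def using 1 2 3
    by (intro exI[of _ "cs @ ls"] exI[of _ "es @ ks"] exI[of _ "K + L"]) simp
qed

lemma sim_add:
  assumes "A \<sim> B" "A' \<sim> B'"
  shows "A + A' \<sim> B + B'"
proof -
  have "A + A' \<sim> B + A'" by (rule sim_add_right[OF assms(1)])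
  also have "B + A' \<sim> B + B'"
    using sim_add_right[OF assms(2), of B] by (simp add: add.commute)
  finally show ?thesis .
qed

lemma sim_repeat: "A \<sim> B \<Longrightarrow> repeat_mset m A \<sim> repeat_mset m B"
  by (induction m) (simp_all add: sim_add)

text \<open>Common constants simply join the ancillas. The argument does not extend to other
  columns, hence the later work on the catalyst.\<close>

lemma sim_cancel:
  assumes "A + K \<sim> B + K" "constants K"
  shows "A \<sim> B"
proof -
  obtain cs ds L where "constants L" "mset cs = A + K + L" "mset ds = B + K + L" "maps cs ds"
    using assms(1) by (auto simp: sim_def)
  then show ?thesis
    unfolding sim_def using assms(2)
    by (intro exI[of _ cs] exI[of _ ds] exI[of _ "K + L"]) (simp add: add.assoc)
qed

subsection \<open>Relations between a column and its negation\<close>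

text \<open>The constants are chosen before \<open>b\<close>; this uniformity is what allows summing
  the relation over a multiset of columns.\<close>

definition rel :: "nat \<Rightarrow> nat \<Rightarrow> nat \<Rightarrow> nat \<Rightarrow> bool" where
  "rel i j i' j' \<longleftrightarrow>
    (\<exists>K K'. constants K \<and> constants K' \<and> (\<forall>b. mix b i j + K \<sim> mix b i' j' + K'))"

lemma rel_refl: "rel i j i j"
  unfolding rel_def by (intro exI[of _ "{#}"]) simp

lemma rel_sym: "rel i j i' j' \<Longrightarrow> rel i' j' i j"
  unfolding rel_def using sim_sym by blast

lemma rel_swap: "rel i j i' j' \<Longrightarrow> rel j i j' i'"
  unfolding rel_def by (metis mix_neg)

lemma rel_add:
  assumes "rel i j i' j'" "rel k l k' l'"
  shows "rel (i + k) (j + l) (i' + k') (j' + l')"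
proof -
  obtain K K' where 1: "constants K" "constants K'" "\<And>b. mix b i j + K \<sim> mix b i' j' + K'"
    using assms(1) by (auto simp: rel_def)
  obtain L L' where 2: "constants L" "constants L'" "\<And>b. mix b k l + L \<sim> mix b k' l' + L'"
    using assms(2) by (auto simp: rel_def)
  have "mix b (i + k) (j + l) + (K + L) \<sim> mix b (i' + k') (j' + l') + (K' + L')" for b
    using sim_add[OF 1(3) 2(3)] by (simp add: mix_add[symmetric] ac_simps)
  then show ?thesis unfolding rel_def using 1 2 by (metis constants_add)
qed

lemma rel_trans [trans]:
  assumes "rel i j i' j'" "rel i' j' i'' j''"
  shows "rel i j i'' j''"
proof -
  obtain K K' where 1: "constants K" "constants K'" "\<And>b. mix b i j + K \<sim> mix b i' j' + K'"
    using assms(1) by (auto simp: rel_def)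
  obtain L L' where 2: "constants L" "constants L'" "\<And>b. mix b i' j' + L \<sim> mix b i'' j'' + L'"
    using assms(2) by (auto simp: rel_def)
  have "mix b i j + (K + L) \<sim> mix b i'' j'' + (K' + L')" for b
    using sim_trans[OF sim_add_right[OF 1(3), of b L]] sim_add_right[OF 2(3), of b K']
    by (simp add: ac_simps)
  then show ?thesis unfolding rel_def using 1 2 by (metis constants_add)
qed

lemma rel_scale: "rel i j i' j' \<Longrightarrow> rel (m * i) (m * j) (m * i') (m * j')"
  by (induction m) (simp_all add: rel_refl rel_add)

lemma rel_gate:
  assumes "(n, F) \<in> C" "length p = n" "length q = n"
  shows "rel (pairs False True p q) (pairs True False p q)
    (pairs False True (F p) (F q)) (pairs True False (F p) (F q))"
proof -
  let ?sel = "\<lambda>b. map2 (\<lambda>u v \<rho>. if b \<rho> then v else u)"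
  let ?K = "\<lambda>p q. replicate_mset (pairs False False p q) (const False) +
     replicate_mset (pairs True True p q) (const True)"
  have len: "length (F p) = n" "length (F q) = n"
    using assms length_gate permutes by metis+
  have row_sel: "row (?sel b p q) \<rho> = (if b \<rho> then q else p)" if "length p = length q" for b p q \<rho>
    using that by (auto simp: row_def intro!: nth_equalityI)
  have "maps (?sel b p q) (?sel b (F p) (F q))" for b
    unfolding maps_def using assms len by (intro exI[of _ F]) (simp add: row_sel)
  then have "mset (?sel b p q) \<sim> mset (?sel b (F p) (F q))" for b by (rule simI)
  moreover have "length p = length q" "length (F p) = length (F q)" using assms len by simp_all
  ultimately have "mix b (pairs False True p q) (pairs True False p q) + ?K p q \<sim>
      mix b (pairs False True (F p) (F q)) (pairs True False (F p) (F q)) + ?K (F p) (F q)" for b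
    by (simp only: mset_select)
  then show ?thesis
    unfolding rel_def
    by (intro exI[of _ "?K p q"] exI[of _ "?K (F p) (F q)"]) (simp add: constants_replicate)
qed

lemma rel_sum:
  assumes "rel i j i' j'"
  obtains K K' where "constants K" "constants K'"
    and "\<And>X. repeat_mset i X + repeat_mset j (image_mset neg X) + repeat_mset (size X) K \<sim>
      repeat_mset i' X + repeat_mset j' (image_mset neg X) + repeat_mset (size X) K'"
proof -
  obtain K K' where K: "constants K" "constants K'" "\<And>b. mix b i j + K \<sim> mix b i' j' + K'"
    using assms by (auto simp: rel_def)
  have split: "repeat_mset k (add_mset b X) + repeat_mset l (image_mset neg (add_mset b X)) +
      repeat_mset (size (add_mset b X)) L =
    (repeat_mset k X + repeat_mset l (image_mset neg X) + repeat_mset (size X) L) + (mix b k l + L)"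
    for k l b X L
    by (simp add: mix_def multiset_eq_iff algebra_simps)
  have "repeat_mset i X + repeat_mset j (image_mset neg X) + repeat_mset (size X) K \<sim>
      repeat_mset i' X + repeat_mset j' (image_mset neg X) + repeat_mset (size X) K'" for X
  proof (induction X)
    case empty
    then show ?case by simp
  next
    case (add b X)
    show ?case unfolding split by (rule sim_add[OF add K(3)])
  qed
  with K that show thesis by blast
qed

text \<open>The changes in the number of \<open>neg b\<close> form a subgroup \<open>J\<close>, by
  adding and reversing relations. If 1 were missing, a modulus would divide every change caused by
  \<open>F\<close>, making \<open>F\<close> self-dual.\<close>

lemma rel_one:
  assumes "(n, F) \<in> C" "\<not> self_dual n F"
  obtains i j k where "rel i (j + 1) k j"
proof -
  define J where "J = {int j - int j' | i j i' j'. rel i j i' j'}"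
  have zero: "0 \<in> J"
    using rel_refl by (force simp: J_def)
  have diff: "x - y \<in> J" if "x \<in> J" "y \<in> J" for x y
  proof -
    obtain i j i' j' k l k' l' where
      *: "rel i j i' j'" "x = int j - int j'" "rel k l k' l'" "y = int l - int l'"
      using \<open>x \<in> J\<close> \<open>y \<in> J\<close> unfolding J_def by blast
    have "rel (i + k') (j + l') (i' + k) (j' + l)"
      by (rule rel_add[OF *(1) rel_sym[OF *(3)]])
    then show ?thesis unfolding J_def using *(2,4) by (force simp: algebra_simps)
  qed
  have "1 \<in> J"
  proof (rule ccontr)
    assume "1 \<notin> J"
    then obtain m where m: "2 \<le> m" "\<And>x. x \<in> J \<Longrightarrow> m dvd x"
      using int_subgroup_dvd[OF zero diff] by blast
    have "self_dual n F"
    proof (rule self_dual_if_congruent[OF permutes[OF assms(1)] m(1)])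
      fix p q :: "bool list" assume "length p = n" "length q = n"
      then have "int (pairs True False (F p) (F q)) - int (pairs True False p q) \<in> J"
        using rel_sym[OF rel_gate[OF assms(1)]] unfolding J_def by blast
      then show "m dvd int (pairs True False (F p) (F q)) - int (pairs True False p q)"
        by (rule m(2))
    qed
    then show False using assms(2) by simp
  qed
  then obtain i j i' j' where "rel i j i' j'" "1 = int j - int j'" unfolding J_def by blast
  moreover from this have "j = j' + 1" by linarith
  ultimately show thesis using that by blast
qed

lemma rel_expanding:
  assumes "(n, F) \<in> C" "\<not> self_dual n F"
  obtains r s where "rel 1 0 r s" "2 \<le> r + s"
proof -
  note F = permutes[OF assms(1)]
  \<comment> \<open>Otherwise \<open>inv F\<close> is 1-Lipschitz, so \<open>F\<close> sends antipodes to antipodes.\<close>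
  have "\<exists>p i. length p = n \<and> i < n \<and> \<not> p ! i \<and> 2 \<le> hamming (inv F p) (inv F (p[i := True]))"
  proof (rule ccontr)
    assume *: "\<not> ?thesis"
    have "F (map Not x) = map Not (F x)" if x: "length x = n" for x
    proof -
      have "hamming (inv F (F x)) (inv F (F (map Not x))) \<le> hamming (F x) (F (map Not x))"
        by (rule hamming_lipschitz[where n = n])
          (use * x in \<open>auto simp: length_gate[OF F] length_gate[OF permutes_inv[OF F]] not_less_eq_eq numeral_2_eq_2\<close>)
      then have "hamming x (map Not x) \<le> hamming (F x) (F (map Not x))"
        by (simp add: permutes_inverses[OF F])
      moreover have "hamming x (map Not x) = n"
      proof -
        have "{i. i < n \<and> x ! i \<noteq> map Not x ! i} = {..<n}" using x by auto
        then show ?thesis using x by (simp add: hamming_def)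
      qed
      ultimately have "card {..<n} \<le> card {i. i < n \<and> F x ! i \<noteq> F (map Not x) ! i}"
        using x by (simp add: hamming_def length_gate[OF F])
      then have "{i. i < n \<and> F x ! i \<noteq> F (map Not x) ! i} = {..<n}"
        by (intro card_seteq) auto
      then show ?thesis
        using x by (intro nth_equalityI) (auto simp: length_gate[OF F])
    qed
    then show False using assms(2) by (simp add: self_dual_def)
  qed
  then obtain p i where p: "length p = n" "i < n" "\<not> p ! i"
    "2 \<le> hamming (inv F p) (inv F (p[i := True]))" by blast
  \<comment> \<open>The two inputs differ only at \<open>i\<close>, so \<open>inv F\<close> is fed a
    single copy of \<open>b\<close> and otherwise constants.\<close>
  have "{j. j < length p \<and> p ! j = False \<and> p[i := True] ! j = True} = {i}"
    "{j. j < length p \<and> p ! j = True \<and> p[i := True] ! j = False} = {}"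
    using p by (auto simp: nth_list_update split: if_splits)
  then have "pairs False True p (p[i := True]) = 1" "pairs True False p (p[i := True]) = 0"
    by (simp_all add: pairs_def)
  then show thesis
    using that rel_gate[OF inverse[OF assms(1)], of p "p[i := True]"] p by (simp add: hamming_pairs)
qed

text \<open>For \<open>p\<close> below \<open>q\<close> the gate receives only copies of
  \<open>b\<close> and constants. Where \<open>F\<close> or \<open>inv F\<close> breaks the order, a
  copy of \<open>neg b\<close> comes out.\<close>

lemma rel_nonmonotone:
  assumes "(n, F) \<in> C" "\<not> self_dual n F"
  obtains d r s where "rel d 0 r s" "1 \<le> s"
proof -
  have "\<exists>G p q. (n, G) \<in> C \<and> list_all2 (\<le>) p q \<and> length q = n \<and> \<not> list_all2 (\<le>) (G p) (G q)"
    using self_dual_if_monotone[OF permutes[OF assms(1)]] assms inverse[OF assms(1)] by metis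
  then obtain G p q where G: "(n, G) \<in> C" and pq: "list_all2 (\<le>) p q" "length q = n"
    and not: "\<not> list_all2 (\<le>) (G p) (G q)" by blast
  have p: "length p = n" using pq by (simp add: list_all2_lengthD)
  have len: "length (G p) = n" "length (G q) = n"
    using length_gate[OF permutes[OF G]] p pq by simp_all
  have "{i. i < length p \<and> p ! i = True \<and> q ! i = False} = {}"
    using pq by (auto simp: list_all2_conv_all_nth)
  then have 0: "pairs True False p q = 0" by (simp add: pairs_def)
  have "{i. i < length (G p) \<and> G p ! i = True \<and> G q ! i = False} \<noteq> {}"
    using not len by (auto simp: list_all2_conv_all_nth)
  then have "1 \<le> pairs True False (G p) (G q)"
    by (simp add: pairs_def Suc_le_eq card_gt_0_iff)
  with rel_gate[OF G p pq(2)] 0 that show thesis by simp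
qed

text \<open>Grow copies of \<open>b\<close>, convert some so that a \<open>neg b\<close> appears
  while a \<open>b\<close> survives, then balance the two surpluses. Iterating makes the surplus as
  large as desired.\<close>

lemma rel_absorb:
  assumes "(n, F) \<in> C" "\<not> self_dual n F"
  obtains T where "N \<le> T" "rel 1 0 (1 + T) T"
proof -
  obtain r s where rs: "rel 1 0 r s" "2 \<le> r + s" by (rule rel_expanding[OF assms])
  obtain d r' s' where d: "rel d 0 r' s'" "1 \<le> s'" by (rule rel_nonmonotone[OF assms])
  have iter: "rel 1 0 (1 + m * k) (m * l)" if *: "rel 1 0 (1 + k) l" for m k l
  proof (induction m)
    case 0
    then show ?case by (simp add: rel_refl)
  next
    case (Suc m)
    note Suc
    also have "rel (1 + m * k) (m * l) (1 + Suc m * k) (Suc m * l)"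
      using rel_add[OF * rel_refl[of "m * k" "m * l"]] by (simp add: algebra_simps)
    finally show ?case .
  qed
  \<comment> \<open>Applying the expansion twice leaves \<open>r * r + s * s\<close> copies of
    \<open>b\<close> itself, at least two even if a single expansion yields only negations.\<close>
  define R where "R = r * r + s * s - 2"
  have "2 \<le> r * r + s * s"
  proof (cases "2 \<le> r \<or> 2 \<le> s")
    case True
    then have "2 * 2 \<le> r * r \<or> 2 * 2 \<le> s * s" using mult_le_mono by blast
    then show ?thesis by linarith
  next
    case False
    then have "r = 1" "s = 1" using rs(2) by linarith+
    then show ?thesis by simp
  qed
  then have R: "r * r + s * s = 1 + (1 + R)" by (simp add: R_def)
  note rs(1)
  also have "rel r s (r * r + s * s) (r * s + s * r)"
    using rel_add[OF rel_scale[OF rs(1), of r] rel_scale[OF rel_swap[OF rs(1)], of s]] by simp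
  finally have "rel 1 0 (1 + (1 + R)) (r * s + s * r)" by (simp only: R)
  then have "rel 1 0 (1 + d * (1 + R)) (d * (r * s + s * r))" by (rule iter)
  \<comment> \<open>Of the surplus, \<open>d\<close> copies of \<open>b\<close> pay for the relation
    that produces \<open>s'\<close> copies of \<open>neg b\<close>.\<close>
  also have "rel (1 + d * (1 + R)) (d * (r * s + s * r)) (1 + (d * R + r')) (d * (r * s + s * r) + s')"
    using rel_add[OF rel_refl[of "1 + d * R" "d * (r * s + s * r)"] d(1)] by (simp add: algebra_simps)
  finally have ij: "rel 1 0 (1 + (d * R + r')) (d * (r * s + s * r) + s')" .
  define i j where "i = d * R + r'" and "j = d * (r * s + s * r) + s' - 1"
  have ij: "rel 1 0 (1 + i) (1 + j)" using ij d(2) by (simp add: i_def j_def)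
  \<comment> \<open>Expanding one \<open>neg b\<close> by the swapped relation adds \<open>j\<close>
    to the first count and \<open>i\<close> to the second, so both surpluses become
    \<open>1 + i + j\<close>.\<close>
  also have "rel (1 + i) (1 + j) (1 + (1 + i + j)) (1 + i + j)"
    using rel_add[OF rel_refl[of "1 + i" j] rel_swap[OF ij]] by (simp add: algebra_simps)
  finally have "rel 1 0 (1 + N * (1 + i + j)) (N * (1 + i + j))" by (rule iter)
  then show thesis using that[of "N * (1 + i + j)"] by simp
qed

subsection \<open>Removing the catalyst\<close>

text \<open>First \<open>X\<close> becomes \<open>Z\<close> beside a catalyst \<open>D\<close>; then
  \<open>D\<close> is created from \<open>X\<close> and dissolved into \<open>Z\<close>. Equal sizes
  make the constants used on both sides match.\<close>

lemma sim_if_sim_neg: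
  assumes "(n, F) \<in> C" "\<not> self_dual n F"
    and sz: "size X = size Z" and neg: "image_mset neg X \<sim> image_mset neg Z"
  shows "X \<sim> Z"
proof -
  define U where "U = (\<lambda>Y. Y + image_mset neg Y)"
  obtain a b c where abc: "rel a (b + 1) c b" by (rule rel_one[OF assms(1,2)])
  obtain L L' where L: "constants L" "constants L'"
    "\<And>X. repeat_mset a X + repeat_mset (b + 1) (image_mset neg X) + repeat_mset (size X) L \<sim>
      repeat_mset c X + repeat_mset b (image_mset neg X) + repeat_mset (size X) L'"
    using rel_sum[OF abc] by metis
  let ?X = "image_mset neg X" and ?Z = "image_mset neg Z"
  let ?L = "repeat_mset (size X) L" and ?L' = "repeat_mset (size X) L'"
  have negneg: "image_mset neg (image_mset neg Y) = Y" for Y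
    by (simp add: multiset.map_comp o_def)
  have LX: "repeat_mset a ?X + repeat_mset (b + 1) X + ?L \<sim> repeat_mset c ?X + repeat_mset b X + ?L'"
    using L(3)[of ?X] by (simp add: negneg)
  have LZ: "repeat_mset a ?Z + repeat_mset (b + 1) Z + ?L \<sim> repeat_mset c ?Z + repeat_mset b Z + ?L'"
    using L(3)[of ?Z] by (simp add: negneg sz)
  \<comment> \<open>\<open>D\<close> holds what \<open>LX\<close> consumes besides one
    \<open>X\<close>, and what \<open>LZ\<close> reversed consumes. The copies of \<open>?X\<close>
    and \<open>?Z\<close> left afterwards have exchanged roles, and \<open>neg\<close> exchanges
    them back.\<close>
  define D where "D = repeat_mset a ?X + repeat_mset c ?Z + repeat_mset b (X + Z)"
  have "(X + D) + ?L =
      (repeat_mset a ?X + repeat_mset (b + 1) X + ?L) + (repeat_mset c ?Z + repeat_mset b Z)"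
    by (simp add: D_def multiset_eq_iff algebra_simps)
  also have "\<dots> \<sim> (repeat_mset c ?X + repeat_mset b X + ?L') + (repeat_mset c ?Z + repeat_mset b Z)"
    by (rule sim_add_right[OF LX])
  also have "\<dots> = (repeat_mset c ?Z + repeat_mset b Z + ?L') + (repeat_mset c ?X + repeat_mset b X)"
    by (simp add: ac_simps)
  also have "\<dots> \<sim> (repeat_mset a ?Z + repeat_mset (b + 1) Z + ?L) + (repeat_mset c ?X + repeat_mset b X)"
    by (rule sim_add_right[OF sim_sym[OF LZ]])
  also have "\<dots> = repeat_mset a ?Z + repeat_mset c ?X + (repeat_mset b (X + Z) + Z + ?L)"
    by (simp add: multiset_eq_iff algebra_simps)
  also have "\<dots> \<sim> repeat_mset a ?X + repeat_mset c ?Z + (repeat_mset b (X + Z) + Z + ?L)"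
    by (intro sim_add_right sim_add sim_repeat neg sim_sym[OF neg])
  also have "\<dots> = (Z + D) + ?L" by (simp add: D_def ac_simps)
  finally have D: "X + D \<sim> Z + D" by (rule sim_cancel) (rule constants_repeat[OF L(1)])

  \<comment> \<open>The bound makes \<open>T\<close> exceed every coefficient in \<open>D\<close>,
    and positive so that one copy of \<open>U Y\<close> can be split off.\<close>
  obtain T where T: "a + b + c + 1 \<le> T" "rel 1 0 (1 + T) T"
    by (rule rel_absorb[OF assms(1,2)])
  obtain K K' where K: "constants K" "constants K'"
    "\<And>X. repeat_mset 1 X + repeat_mset 0 (image_mset neg X) + repeat_mset (size X) K \<sim>
      repeat_mset (1 + T) X + repeat_mset T (image_mset neg X) + repeat_mset (size X) K'"
    using rel_sum[OF T(2)] by metis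
  have expand: "Y + repeat_mset (size Y) K \<sim> Y + repeat_mset T (U Y) + repeat_mset (size Y) K'" for Y
    using K(3)[of Y] by (simp add: U_def ac_simps)
  \<comment> \<open>Expanding \<open>Y\<close> frees a copy of its negation. This is turned into the
    negation of \<open>W\<close>, expanded to produce \<open>U W\<close>, and turned back.\<close>
  have absorb: "Y + repeat_mset (2 * size Y) K \<sim>
      Y + repeat_mset T (U Y + U W) + repeat_mset (2 * size Y) K'"
    if YW: "size W = size Y" "image_mset neg Y \<sim> image_mset neg W" for Y W
  proof -
    let ?K = "repeat_mset (size Y) K" and ?K' = "repeat_mset (size Y) K'"
    obtain T' where T': "T = Suc T'" using T(1) by (cases T) auto
    define V where "V = Y + Y + repeat_mset T' (U Y) + ?K'"
    have V: "Y + repeat_mset T (U Y) + ?K' = image_mset neg Y + V"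
      by (simp add: V_def T' U_def ac_simps)
    have UW: "U (image_mset neg W) = U W" by (simp add: U_def negneg add.commute)
    have "Y + repeat_mset (2 * size Y) K = (Y + ?K) + ?K"
      by (simp add: multiset_eq_iff)
    also have "\<dots> \<sim> (image_mset neg Y + V) + ?K"
      unfolding V[symmetric] by (rule sim_add_right[OF expand])
    also have "\<dots> = image_mset neg Y + (V + ?K)" by (simp add: ac_simps)
    also have "\<dots> \<sim> image_mset neg W + (V + ?K)" by (rule sim_add_right[OF YW(2)])
    also have "\<dots> = (image_mset neg W + ?K) + V" by (simp add: ac_simps)
    also have "\<dots> \<sim> (image_mset neg W + repeat_mset T (U W) + ?K') + V"
      using sim_add_right[OF expand[of "image_mset neg W"], of V] by (simp add: UW YW(1))
    also have "\<dots> = image_mset neg W + (repeat_mset T (U W) + ?K' + V)" by (simp add: ac_simps)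
    also have "\<dots> \<sim> image_mset neg Y + (repeat_mset T (U W) + ?K' + V)"
      by (rule sim_add_right[OF sim_sym[OF YW(2)]])
    also have "\<dots> = (image_mset neg Y + V) + (repeat_mset T (U W) + ?K')" by (simp add: ac_simps)
    also have "\<dots> = Y + repeat_mset T (U Y + U W) + repeat_mset (2 * size Y) K'"
      unfolding V[symmetric] by (simp add: multiset_eq_iff algebra_simps)
    finally show ?thesis .
  qed
  let ?K = "repeat_mset (2 * size X) K" and ?K' = "repeat_mset (2 * size X) K'"
  define W where "W = repeat_mset T (U X + U Z)"
  have "D \<subseteq># W"
  proof (rule mset_subset_eqI)
    fix e
    have "count D e = a * count ?X e + c * count ?Z e + b * (count X e + count Z e)"
      by (simp add: D_def algebra_simps)
    also have "\<dots> \<le> T * count ?X e + T * count ?Z e + T * (count X e + count Z e)"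
      using T(1) by (intro add_mono mult_le_mono1) simp_all
    also have "\<dots> = count W e" by (simp add: W_def U_def algebra_simps)
    finally show "count D e \<le> count W e" .
  qed
  then obtain D' where D': "W = D + D'" by (auto simp: mset_subset_eq_exists_conv)
  \<comment> \<open>\<open>X\<close> creates \<open>W\<close>, the part \<open>D\<close> of
    \<open>W\<close> serves as catalyst, and \<open>Z\<close> reabsorbs \<open>W\<close>.\<close>
  have "X + ?K \<sim> X + W + ?K'" unfolding W_def by (rule absorb[OF sz[symmetric] neg])
  also have "\<dots> = (X + D) + (D' + ?K')" by (simp add: D' ac_simps)
  also have "\<dots> \<sim> (Z + D) + (D' + ?K')" by (rule sim_add_right[OF D])
  also have "\<dots> = Z + W + ?K'" by (simp add: D' ac_simps)
  also have "\<dots> \<sim> Z + ?K"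
    using sim_sym[OF absorb[OF sz sim_sym[OF neg]]] by (simp add: W_def sz add.commute)
  finally show ?thesis by (rule sim_cancel) (rule constants_repeat[OF K(1)])
qed

text \<open>Take the coordinate projections as \<open>xs\<close>. Then \<open>F\<close> maps their
  negations to \<open>ys\<close>, whose negations \<open>zs\<close> compute the dual. The resulting
  conversion of \<open>xs\<close> to \<open>zs\<close> is one gate with constant ancillas, which the
  ancilla rule strips.\<close>

lemma dual_closed:
  assumes F: "(n, F) \<in> C"
  shows "(n, dual n F) \<in> C"
proof (cases "self_dual n F")
  case True
  then show ?thesis using F dual_self_dual[OF permutes[OF F]] by simp
next
  case False
  define xs :: "column list" where "xs = map (\<lambda>i \<rho>. \<rho> ! i) [0..<n]"
  define ys where "ys = map (\<lambda>i \<rho>. F (row (map neg xs) \<rho>) ! i) [0..<n]"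
  define zs where "zs = map neg ys"
  have len: "length xs = n" "length ys = n" "length zs = n"
    by (simp_all add: xs_def ys_def zs_def)
  have row_neg: "row (map neg cs) \<rho> = map Not (row cs \<rho>)" for cs \<rho>
    by (simp add: row_def neg_def)
  have row_xs: "row xs \<rho> = \<rho>" if "length \<rho> = n" for \<rho>
    using that by (auto simp: row_def xs_def intro!: nth_equalityI)
  \<comment> \<open>This holds for \<open>\<rho>\<close> of any length, as \<open>maps\<close>
    demands, because the row fed to \<open>F\<close> always has length \<open>n\<close>.\<close>
  have row_ys: "F (row (map neg xs) \<rho>) = row ys \<rho>" for \<rho>
    proof (rule nth_equalityI)
    show "length (F (row (map neg xs) \<rho>)) = length (row ys \<rho>)"
      using length_gate[OF permutes[OF F], of "row (map neg xs) \<rho>"] len by simp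
    then show "F (row (map neg xs) \<rho>) ! i = row ys \<rho> ! i" if "i < length (F (row (map neg xs) \<rho>))" for i
      using that len by (simp add: row_def ys_def)
  qed
  have negneg: "neg \<circ> neg = id" by (simp add: fun_eq_iff)
  have "maps (map neg xs) ys"
    unfolding maps_def using F row_ys len by auto
  then have "image_mset neg (mset xs) \<sim> image_mset neg (mset zs)"
    using simI by (fastforce simp: zs_def negneg multiset.map_comp)
  then have "mset xs \<sim> mset zs"
    using sim_if_sim_neg[OF F False] len by simp
  then obtain cs ds K where *: "constants K" "mset cs = mset xs + K" "mset ds = mset zs + K" "maps cs ds"
    by (auto simp: sim_def)
  obtain ks where ks: "mset ks = K" using ex_mset by blast
  have "maps (xs @ ks) (zs @ ks)"
    by (rule maps_permute[OF *(4)]) (simp_all add: * ks)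
  then obtain G where G: "(n + length ks, G) \<in> C" "\<And>\<rho>. G (row (xs @ ks) \<rho>) = row (zs @ ks) \<rho>"
    by (auto simp: maps_def len)
  have "set ks \<subseteq> range const" using *(1) ks by (auto simp: constants_def)
  \<comment> \<open>Constant columns ignore the assignment; the empty list is an arbitrary
    representative.\<close>
  then have const: "row ks \<rho> = row ks []" for \<rho>
    by (auto simp: row_def const_def)
  show ?thesis
  proof (rule ancilla[OF G(1)])
    show "row ks [] \<in> bitstrings (length ks)" by (simp add: bitstrings_def)
    show "(n, dual n F) \<in> reversible_gates" by (rule dual_reversible[OF reversible[OF F]])
    fix x assume "x \<in> bitstrings n"
    then have x: "length x = n" by (simp add: bitstrings_def)
    have "row zs x = dual n F x"
      using x by (simp add: zs_def row_neg row_ys[symmetric] row_xs dual_def on_bits_def)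
    then show "G (x @ row ks []) = dual n F x @ row ks []"
      using G(2)[of x] x by (simp add: row_xs const[of x])
  qed
qed

end

theorem corollary6:
  fixes C :: "gate set" and n :: nat and F :: "bool list \<Rightarrow> bool list"
  assumes "reversible_gate_class C"
    and "(n, F) \<in> C"
  shows "(n, dual n F) \<in> C"
proof -
  interpret gate_class C by unfold_locales (rule assms(1))
  show ?thesis by (rule dual_closed[OF assms(2)])
qed

end
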